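(* Let $N>1$ be an integer and let $A_N$ be the generalized ring $$\mathbf n\mapsto A_N(\mathbf n)=\Big\{(\lambda_1,\dots,\lambda_n)\in\mathbb{Z}[N^{-1}]^n:\ \sum_{i=1}^n|\lambda_i|\le 1\Big\}.$$ If $P$ is a finitely generated projective $A_N$-module, then $P$ is free, i.e. $P\simeq A_N(\mathbf m)$ as an $A_N$-module for some integer $m\ge0$.
   Context: $\mathbf n=\{1,\dots,n\}$. $A_N$ is the following monad on the category of sets: for a set $X$, $A_N(X)$ is the set of finitely supported functions $\lambda:X\to\mathbb{Z}[N^{-1}]$ with $\sum_{x}|\lambda(x)|\le1$, viewed as formal linear combinations; it is functorial by pushforward of formal linear combinations; the unit $\epsilon_X:X\to A_N(X)$ sends $x$ to its characteristic function; the multiplication $\mu_X:A_N(A_N(X))\to A_N(X)$ evaluates a formal linear combination of formal linear combinations. An $A_N$-module is an algebra for this monad: a set $X$ with a map $\alpha:A_N(X)\to X$ such that $\alpha\circ\mu_X=\alpha\circ A_N(\alpha)$ and $\alpha\circ\epsilon_X=\mathrm{id}_X$. A morphism $f:(X,\alpha_X)\to(Y,\alpha_Y)$ is a map of sets with $f\circ\alpha_X=\alpha_Y\circ A_N(f)$. An $A_N$-module $F$ is free if there is $n\in\mathbb N$ such that $\mathrm{Hom}_{A_N}(F,X)\simeq X^n$ naturally for any $A_N$-module $X$, equivalently $F\simeq A_N(\mathbf n)$. An $A_N$-module $P$ is projective if every surjection $\pi:X\to P$ of $A_N$-modules admits a section $\sigma:P\to X$ that is a morphism of $A_N$-modules.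 A projective module is finitely generated if it admits a surjection from a free module. *)

theory Defs
  imports Complex_Main
begin

definition Z_inv :: "nat \<Rightarrow> rat set" where
  "Z_inv N = {of_int a / of_nat N ^ k | (a::int) (k::nat). True}"

definition A_supp :: "('a \<Rightarrow> rat) \<Rightarrow> 'a set" where
  "A_supp l = {x. l x \<noteq> 0}"

text \<open>A function from \<open>X\<close> to \<open>\<int>[N\<^sup>-\<^sup>1]\<close> is encoded as a function on the whole type
  that vanishes outside \<open>X\<close>.\<close>

definition A_N :: "nat \<Rightarrow> 'a set \<Rightarrow> ('a \<Rightarrow> rat) set" where
  "A_N N X = {l. finite (A_supp l) \<and> A_supp l \<subseteq> X \<and> (\<forall>x. l x \<in> Z_inv N)
              \<and> (\<Sum>x\<in>A_supp l. \<bar>l x\<bar>) \<le> 1}"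

definition A_push :: "('a \<Rightarrow> 'b) \<Rightarrow> ('a \<Rightarrow> rat) \<Rightarrow> ('b \<Rightarrow> rat)" where
  "A_push f l = (\<lambda>y. \<Sum>x\<in>{x \<in> A_supp l. f x = y}. l x)"

definition A_unit :: "'a \<Rightarrow> ('a \<Rightarrow> rat)" where
  "A_unit x = (\<lambda>y. if y = x then 1 else 0)"

definition A_mult :: "(('a \<Rightarrow> rat) \<Rightarrow> rat) \<Rightarrow> ('a \<Rightarrow> rat)" where
  "A_mult L = (\<lambda>x. \<Sum>l\<in>A_supp L. L l * l x)"

record 'a alg =
  carrier :: "'a set"
  act :: "('a \<Rightarrow> rat) \<Rightarrow> 'a"

definition A_module :: "nat \<Rightarrow> 'a alg \<Rightarrow> bool" where
  "A_module N M \<longleftrightarrow>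
     (\<forall>l\<in>A_N N (carrier M). act M l \<in> carrier M) \<and>
     (\<forall>L\<in>A_N N (A_N N (carrier M)). act M (A_mult L) = act M (A_push (act M) L)) \<and>
     (\<forall>x\<in>carrier M. act M (A_unit x) = x)"

definition A_hom :: "nat \<Rightarrow> 'a alg \<Rightarrow> 'b alg \<Rightarrow> ('a \<Rightarrow> 'b) \<Rightarrow> bool" where
  "A_hom N M M' f \<longleftrightarrow>
     (\<forall>x\<in>carrier M. f x \<in> carrier M') \<and>
     (\<forall>l\<in>A_N N (carrier M). f (act M l) = act M' (A_push f l))"

definition A_iso :: "nat \<Rightarrow> 'a alg \<Rightarrow> 'b alg \<Rightarrow> bool" where
  "A_iso N M M' \<longleftrightarrow>
     (\<exists>f g. A_hom N M M' f \<and> A_hom N M' M g \<and>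
        (\<forall>x\<in>carrier M. g (f x) = x) \<and> (\<forall>y\<in>carrier M'. f (g y) = y))"

definition A_std :: "nat \<Rightarrow> nat \<Rightarrow> (nat \<Rightarrow> rat) alg" where
  "A_std N n = \<lparr>carrier = A_N N {1..n}, act = A_mult\<rparr>"

definition A_free :: "nat \<Rightarrow> 'a alg \<Rightarrow> bool" where
  "A_free N F \<longleftrightarrow> A_module N F \<and> (\<exists>n. A_iso N F (A_std N n))"

text \<open>Higher-order logic cannot quantify over the carrier types of all modules \<open>X\<close> inside a
  definition, so projectivity is relative to a type \<open>'u\<close> in which the carriers of the \<open>X\<close> live.
  For finitely generated \<open>P\<close>, every infinite \<open>'u\<close> yields the same notion: the countable
  module \<open>A_N N {1..n}\<close> then has a copy with carrier in \<open>'u\<close>, and if a surjection from it onto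
  \<open>P\<close> splits, then so does every surjection onto \<open>P\<close>, whatever its source.\<close>

definition A_projective :: "'u itself \<Rightarrow> nat \<Rightarrow> 'a alg \<Rightarrow> bool" where
  "A_projective (_ :: 'u itself) N P \<longleftrightarrow> A_module N P \<and>
     (\<forall>(X :: 'u alg) p.
        A_module N X \<longrightarrow> A_hom N X P p \<longrightarrow> p ` carrier X = carrier P \<longrightarrow>
        (\<exists>s. A_hom N P X s \<and> (\<forall>y\<in>carrier P. p (s y) = y)))"

definition A_fin_gen :: "nat \<Rightarrow> 'a alg \<Rightarrow> bool" where
  "A_fin_gen N P \<longleftrightarrow>
     (\<exists>n f. A_hom N (A_std N n) P f \<and> f ` carrier (A_std N n) = carrier P)"

end

theory Submission
  imports Defs "HOL-Library.Countable_Set"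
begin

text \<open>A finitely generated projective module is the image of an idempotent endomorphism \<open>e\<close> of
  some \<open>A_N(n)\<close>, that is, of an idempotent matrix whose columns have \<open>\<ell>\<^sup>1\<close>-norm at most \<open>1\<close>. Since
  \<open>e\<close> is contractive, a fixed vector \<open>x\<close> suffers no cancellation in \<open>e x = x\<close>, and so the support
  of \<open>x\<close> contains the support of each column whose index lies in it. Therefore the minimal supports
  of nonzero fixed vectors are pairwise disjoint, and each of them is the support of a column of norm
  \<open>1\<close>. Choosing one such column \<open>u\<^sub>i\<close> per minimal support gives a basis of the fixed vectors. The
  coefficient of \<open>u\<^sub>i\<close> in \<open>x\<close> is the sum of \<open>sgn (u\<^sub>i k) * x k\<close> over all \<open>k\<close>, hence lies in
  \<open>\<int>[N\<^sup>-\<^sup>1]\<close>, and the norm of \<open>x\<close> is the sum of the absolute values of its coefficients.\<close>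

section \<open>The ring of coefficients\<close>

lemma Z_inv_of_int: "of_int a \<in> Z_inv N"
  unfolding Z_inv_def by (rule CollectI, rule exI[of _ a], rule exI[of _ 0]) simp

lemma Z_inv_0 [simp]: "0 \<in> Z_inv N"
  using Z_inv_of_int[of 0] by simp

lemma Z_inv_add:
  assumes "N > 0" "x \<in> Z_inv N" "y \<in> Z_inv N"
  shows "x + y \<in> Z_inv N"
proof -
  obtain a k b m where x: "x = of_int a / of_nat N ^ k" and y: "y = of_int b / of_nat N ^ m"
    using assms unfolding Z_inv_def by blast
  have "x + y = of_int (a * int N ^ m + b * int N ^ k) / of_nat N ^ (k + m)"
    using \<open>N > 0\<close> by (simp add: x y field_simps power_add)
  then show ?thesis unfolding Z_inv_def by blast
qed

lemma Z_inv_mult: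
  assumes "x \<in> Z_inv N" "y \<in> Z_inv N"
  shows "x * y \<in> Z_inv N"
proof -
  obtain a k b m where x: "x = of_int a / of_nat N ^ k" and y: "y = of_int b / of_nat N ^ m"
    using assms unfolding Z_inv_def by blast
  have "x * y = of_int (a * b) / of_nat N ^ (k + m)"
    by (simp add: x y power_add)
  then show ?thesis unfolding Z_inv_def by blast
qed

lemma Z_inv_sum:
  assumes "N > 0" "\<And>i. i \<in> S \<Longrightarrow> f i \<in> Z_inv N"
  shows "sum f S \<in> Z_inv N"
  using assms(2) by (induction S rule: infinite_finite_induct) (auto intro: Z_inv_add[OF assms(1)])

text \<open>Signs will be the entries of the matrix that reads off coefficients in a basis, which
  must lie in the ring.\<close>

lemma Z_inv_sgn: "sgn x \<in> Z_inv N"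
  using Z_inv_of_int[of 1 N] Z_inv_of_int[of "-1" N] by (auto simp: sgn_if)

section \<open>The monad\<close>

text \<open>The linear extension of \<open>\<phi>\<close> to formal combinations. Values of
  pushforwards and products are instances of it, so the monad laws reduce to the two rules
  \<open>A_int_push\<close> and \<open>A_int_mult\<close>.\<close>

definition A_int :: "('a \<Rightarrow> rat) \<Rightarrow> ('a \<Rightarrow> rat) \<Rightarrow> rat" where
  "A_int \<phi> l = (\<Sum>x\<in>A_supp l. l x * \<phi> x)"

lemma A_int_superset:
  assumes "finite S" "A_supp l \<subseteq> S"
  shows "A_int \<phi> l = (\<Sum>x\<in>S. l x * \<phi> x)"
  unfolding A_int_def using assms by (intro sum.mono_neutral_left) (auto simp: A_supp_def)

lemma A_int_cong:
  "(\<And>x. x \<in> A_supp l \<Longrightarrow> \<phi> x = \<psi> x) \<Longrightarrow> A_int \<phi> l = A_int \<psi> l"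
  unfolding A_int_def by (rule sum.cong) auto

lemma A_mult_eq_int: "A_mult L x = A_int (\<lambda>l. l x) L"
  by (simp add: A_mult_def A_int_def)

lemma A_push_eq_int:
  assumes "finite (A_supp l)"
  shows "A_push f l y = A_int (\<lambda>x. of_bool (f x = y)) l"
  unfolding A_push_def A_int_def using assms by (intro sum.mono_neutral_cong_left) auto

lemma A_supp_push: "A_supp (A_push f l) \<subseteq> f ` A_supp l"
proof
  fix y assume "y \<in> A_supp (A_push f l)"
  then have "(\<Sum>x\<in>{x \<in> A_supp l. f x = y}. l x) \<noteq> 0"
    unfolding A_supp_def[of "A_push f l"] by (simp add: A_push_def)
  then obtain x where "x \<in> {x \<in> A_supp l. f x = y}"
    by (rule sum.not_neutral_contains_not_neutral)
  then show "y \<in> f ` A_supp l" by auto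
qed

lemma A_supp_mult: "A_supp (A_mult L) \<subseteq> (\<Union>l\<in>A_supp L. A_supp l)"
proof
  fix x assume "x \<in> A_supp (A_mult L)"
  then have "(\<Sum>l\<in>A_supp L. L l * l x) \<noteq> 0" by (simp add: A_supp_def A_mult_def)
  then obtain l where "l \<in> A_supp L" "L l * l x \<noteq> 0"
    by (rule sum.not_neutral_contains_not_neutral)
  then show "x \<in> (\<Union>l\<in>A_supp L. A_supp l)" by (auto simp: A_supp_def)
qed

text \<open>Change of variables: the sum over the support of \<open>l\<close> is grouped by the
  fibres of \<open>f\<close>.\<close>

lemma A_int_push:
  assumes "finite (A_supp l)"
  shows "A_int \<phi> (A_push f l) = A_int (\<phi> \<circ> f) l"
proof -
  have "A_int \<phi> (A_push f l) = (\<Sum>y\<in>f ` A_supp l. A_push f l y * \<phi> y)"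
    using assms by (intro A_int_superset A_supp_push) auto
  also have "\<dots> = (\<Sum>y\<in>f ` A_supp l. \<Sum>x\<in>{x \<in> A_supp l. f x = y}. l x * \<phi> (f x))"
    unfolding A_push_def by (auto simp: sum_distrib_right intro!: sum.cong)
  also have "\<dots> = A_int (\<phi> \<circ> f) l"
    unfolding A_int_def using assms by (subst sum.group) auto
  finally show ?thesis .
qed

text \<open>A finite Fubini theorem. All inner supports are enlarged to the common set
  \<open>S\<close>, so that the two summations can be exchanged.\<close>

lemma A_int_mult:
  assumes "finite (A_supp L)" "\<And>l. l \<in> A_supp L \<Longrightarrow> finite (A_supp l)"
  shows "A_int \<phi> (A_mult L) = A_int (A_int \<phi>) L"
proof -
  define S where "S = (\<Union>l\<in>A_supp L. A_supp l)"
  have S: "finite S" "\<And>l. l \<in> A_supp L \<Longrightarrow> A_supp l \<subseteq> S"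
    using assms by (auto simp: S_def)
  have "A_int \<phi> (A_mult L) = (\<Sum>x\<in>S. \<Sum>l\<in>A_supp L. L l * l x * \<phi> x)"
    using S A_supp_mult[of L] unfolding S_def[symmetric]
    by (subst A_int_superset[of S]) (auto simp: A_mult_def sum_distrib_right)
  also have "\<dots> = (\<Sum>l\<in>A_supp L. L l * (\<Sum>x\<in>S. l x * \<phi> x))"
    by (subst sum.swap) (simp add: sum_distrib_left mult.assoc)
  also have "\<dots> = A_int (A_int \<phi>) L"
    unfolding A_int_def[of "A_int \<phi>"] using S by (intro sum.cong) (auto simp: A_int_superset[of S])
  finally show ?thesis .
qed

section \<open>Membership in \<open>A_N\<close> and closure under the monad operations\<close>

lemma A_N_D:
  assumes "l \<in> A_N N X"
  shows "finite (A_supp l)" "A_supp l \<subseteq> X" "l x \<in> Z_inv N" "(\<Sum>x\<in>A_supp l. \<bar>l x\<bar>) \<le> 1"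
  using assms by (auto simp: A_N_def)

lemma A_N_norm_le:
  assumes "l \<in> A_N N X" "finite S"
  shows "(\<Sum>x\<in>S. \<bar>l x\<bar>) \<le> 1"
proof -
  have "(\<Sum>x\<in>S. \<bar>l x\<bar>) = (\<Sum>x\<in>S \<inter> A_supp l. \<bar>l x\<bar>)"
    using assms by (intro sum.mono_neutral_right) (auto simp: A_supp_def)
  also have "\<dots> \<le> (\<Sum>x\<in>A_supp l. \<bar>l x\<bar>)"
    using A_N_D(1)[OF assms(1)] by (intro sum_mono2) auto
  finally show ?thesis using A_N_D(4)[OF assms(1)] by simp
qed

text \<open>Cancellation can shrink the support of a pushforward or a product, so the norm is
  bounded on a known finite superset \<open>S\<close> of the support instead.\<close>

lemma A_N_I:
  assumes "finite S" "A_supp l \<subseteq> S" "S \<subseteq> X" "\<And>x. l x \<in> Z_inv N" "(\<Sum>x\<in>S. \<bar>l x\<bar>) \<le> 1"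
  shows "l \<in> A_N N X"
proof -
  have "(\<Sum>x\<in>A_supp l. \<bar>l x\<bar>) = (\<Sum>x\<in>S. \<bar>l x\<bar>)"
    using assms by (intro sum.mono_neutral_left) (auto simp: A_supp_def)
  then show ?thesis using assms finite_subset[of "A_supp l" S] by (auto simp: A_N_def)
qed

lemma A_push_in_A_N:
  assumes "N > 0" "l \<in> A_N N X" "f ` X \<subseteq> Y"
  shows "A_push f l \<in> A_N N Y"
proof (rule A_N_I)
  note l = A_N_D[OF assms(2)]
  show "finite (f ` A_supp l)" "A_supp (A_push f l) \<subseteq> f ` A_supp l" "f ` A_supp l \<subseteq> Y"
    using l assms(3) by (auto intro!: A_supp_push)
  show "A_push f l x \<in> Z_inv N" for x
    unfolding A_push_def using assms l by (intro Z_inv_sum)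
  have "(\<Sum>y\<in>f ` A_supp l. \<bar>A_push f l y\<bar>)
      \<le> (\<Sum>y\<in>f ` A_supp l. \<Sum>x\<in>{x \<in> A_supp l. f x = y}. \<bar>l x\<bar>)"
    unfolding A_push_def by (intro sum_mono sum_abs)
  also have "\<dots> = (\<Sum>x\<in>A_supp l. \<bar>l x\<bar>)"
    using l by (intro sum.group) auto
  finally show "(\<Sum>y\<in>f ` A_supp l. \<bar>A_push f l y\<bar>) \<le> 1" using l(4) by simp
qed

lemma A_mult_in_A_N:
  assumes "N > 0" "L \<in> A_N N (A_N N X)"
  shows "A_mult L \<in> A_N N X"
proof (rule A_N_I)
  note L = A_N_D[OF assms(2)]
  define S where "S = (\<Union>l\<in>A_supp L. A_supp l)"
  have inA: "l \<in> A_N N X" if "l \<in> A_supp L" for l using that L by auto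
  show "finite (\<Union>l\<in>A_supp L. A_supp l)" "A_supp (A_mult L) \<subseteq> (\<Union>l\<in>A_supp L. A_supp l)"
    "(\<Union>l\<in>A_supp L. A_supp l) \<subseteq> X"
    using L(1) A_N_D(1,2)[OF inA] by (auto intro!: A_supp_mult)
  then have S: "finite S" by (simp add: S_def)
  show "A_mult L x \<in> Z_inv N" for x
    unfolding A_mult_def using assms(1) L(3) A_N_D(3)[OF inA] by (intro Z_inv_sum Z_inv_mult)
  have "(\<Sum>x\<in>S. \<bar>A_mult L x\<bar>) \<le> (\<Sum>x\<in>S. \<Sum>l\<in>A_supp L. \<bar>L l\<bar> * \<bar>l x\<bar>)"
    unfolding A_mult_def by (intro sum_mono order_trans[OF sum_abs]) (simp add: abs_mult)
  also have "\<dots> = (\<Sum>l\<in>A_supp L. \<bar>L l\<bar> * (\<Sum>x\<in>S. \<bar>l x\<bar>))"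
    by (subst sum.swap) (simp add: sum_distrib_left)
  also have "\<dots> \<le> (\<Sum>l\<in>A_supp L. \<bar>L l\<bar> * 1)"
    using S inA by (intro sum_mono mult_left_mono A_N_norm_le) auto
  finally show "(\<Sum>x\<in>(\<Union>l\<in>A_supp L. A_supp l). \<bar>A_mult L x\<bar>) \<le> 1"
    using L(4) by (simp add: S_def)
qed

lemma A_unit_in_A_N:
  assumes "x \<in> X"
  shows "A_unit x \<in> A_N N X"
  using assms Z_inv_of_int[of 1 N]
  by (intro A_N_I[of "{x}"]) (auto simp: A_supp_def A_unit_def)

section \<open>Functoriality, naturality and the monad laws\<close>

lemma A_push_comp:
  assumes "finite (A_supp l)"
  shows "A_push g (A_push f l) = A_push (g \<circ> f) l"
proof
  fix y
  have "finite (A_supp (A_push f l))" using assms A_supp_push finite_surj by metis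
  then show "A_push g (A_push f l) y = A_push (g \<circ> f) l y"
    by (simp add: A_push_eq_int A_int_push assms o_def)
qed

lemma A_push_cong:
  "(\<And>x. x \<in> A_supp l \<Longrightarrow> f x = g x) \<Longrightarrow> A_push f l = A_push g l"
  unfolding A_push_def by (intro ext sum.cong) auto

lemma A_push_ident:
  assumes "\<And>x. x \<in> A_supp l \<Longrightarrow> f x = x"
  shows "A_push f l = l"
proof
  fix y
  have "{x \<in> A_supp l. f x = y} = (if y \<in> A_supp l then {y} else {})"
    using assms by auto
  then show "A_push f l y = l y" by (auto simp: A_push_def A_supp_def)
qed

lemma A_push_mult:
  assumes "L \<in> A_N N (A_N N X)"
  shows "A_push f (A_mult L) = A_mult (A_push (A_push f) L)"
proof
  fix y
  note L = A_N_D[OF assms]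
  have fin: "finite (A_supp l)" if "l \<in> A_supp L" for l
    using that L(2) A_N_D(1) by blast
  have "finite (A_supp (A_mult L))"
    using L fin by (intro finite_subset[OF A_supp_mult]) auto
  then show "A_push f (A_mult L) y = A_mult (A_push (A_push f) L) y"
    using L(1) fin
    by (auto simp: A_push_eq_int A_mult_eq_int A_int_push A_int_mult intro!: A_int_cong)
qed

text \<open>At a point \<open>x\<close>, both sides reduce to the iterated linear extension of
  evaluation at \<open>x\<close>, applied to \<open>L\<close>.\<close>

lemma A_mult_assoc:
  assumes "L \<in> A_N N (A_N N X)"
  shows "A_mult (A_mult L) = A_mult (A_push A_mult L)"
proof
  fix x
  note L = A_N_D[OF assms]
  have fin: "finite (A_supp l)" if "l \<in> A_supp L" for l
    using that L(2) A_N_D(1) by blast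
  show "A_mult (A_mult L) x = A_mult (A_push A_mult L) x"
    using L(1) fin
    by (auto simp: A_mult_eq_int A_int_push A_int_mult intro!: A_int_cong)
qed

lemma A_int_unit: "A_int \<phi> (A_unit x) = \<phi> x"
  by (subst A_int_superset[of "{x}"]) (auto simp: A_supp_def A_unit_def)

lemma finite_supp_unit: "finite (A_supp (A_unit x))"
  by (rule finite_subset[of _ "{x}"]) (auto simp: A_supp_def A_unit_def)

lemma A_mult_unit: "A_mult (A_unit l) = l"
  by (simp add: fun_eq_iff A_mult_eq_int A_int_unit)

lemma A_push_unit: "A_push f (A_unit x) = A_unit (f x)"
  by (auto simp: fun_eq_iff A_push_eq_int finite_supp_unit A_int_unit A_unit_def[of "f x"])

lemma A_mult_push_unit:
  assumes "finite (A_supp l)"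
  shows "A_mult (A_push A_unit l) = l"
proof
  fix x
  have "A_mult (A_push A_unit l) x = A_push id l x"
    using assms unfolding A_mult_eq_int A_push_eq_int[OF assms] A_int_push[OF assms]
    by (intro A_int_cong) (auto simp: A_unit_def)
  then show "A_mult (A_push A_unit l) x = l x" by (simp add: A_push_ident)
qed

section \<open>Modules\<close>

lemma A_std_module:
  assumes "N > 0"
  shows "A_module N (A_std N n)"
  unfolding A_module_def A_std_def
  using A_mult_in_A_N[OF assms] A_mult_unit by (auto intro: A_mult_assoc)

lemma A_hom_comp:
  assumes "N > 0" "A_hom N M M' f" "A_hom N M' M'' g"
  shows "A_hom N M M'' (g \<circ> f)"
proof -
  have f: "f x \<in> carrier M'" if "x \<in> carrier M" for x
    using that assms(2) by (simp add: A_hom_def)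
  have "g (f (act M l)) = act M'' (A_push (g \<circ> f) l)" if l: "l \<in> A_N N (carrier M)" for l
    using assms(2,3) l A_push_in_A_N[OF assms(1) l, of f "carrier M'"] f
    by (auto simp: A_hom_def image_subset_iff A_push_comp[OF A_N_D(1)[OF l], symmetric])
  then show ?thesis using assms(2,3) by (auto simp: A_hom_def)
qed

text \<open>Existence half of the universal property of the free module: the generators may be sent
  to arbitrary elements \<open>w i\<close>. Naturality of the multiplication and the associativity
  law of \<open>M\<close> make the extension a morphism.\<close>

lemma A_hom_free:
  assumes "N > 0" "A_module N M" "\<And>i. i \<in> {1..n} \<Longrightarrow> w i \<in> carrier M"
  shows "A_hom N (A_std N n) M (\<lambda>l. act M (A_push w l))"
  unfolding A_hom_def
proof (intro conjI ballI)
  have inM: "A_push w l \<in> A_N N (carrier M)" if "l \<in> A_N N {1..n}" for l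
    using that assms(3) by (intro A_push_in_A_N[OF assms(1)]) auto
  then show "act M (A_push w l) \<in> carrier M" if "l \<in> carrier (A_std N n)" for l
    using that assms(2) by (auto simp: A_std_def A_module_def)
  fix L assume "L \<in> A_N N (carrier (A_std N n))"
  then have L: "L \<in> A_N N (A_N N {1..n})" by (simp add: A_std_def)
  have "act M (A_push w (A_mult L)) = act M (A_mult (A_push (A_push w) L))"
    by (simp add: A_push_mult[OF L])
  also have "\<dots> = act M (A_push (act M) (A_push (A_push w) L))"
    using assms(2) A_push_in_A_N[OF assms(1) L, of "A_push w"] inM by (auto simp: A_module_def)
  also have "\<dots> = act M (A_push (\<lambda>l. act M (A_push w l)) L)"
    by (simp add: A_push_comp[OF A_N_D(1)[OF L]] o_def)
  finally show "act M (A_push w (act (A_std N n) L)) = act M (A_push (\<lambda>l. act M (A_push w l)) L)"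
    by (simp add: A_std_def)
qed

text \<open>Uniqueness half of the universal property: \<open>l\<close> is the combination of the
  units \<open>A_unit i\<close> with its own coefficients, so \<open>f\<close> is determined by its
  values on the units.\<close>

lemma A_hom_std_eq:
  assumes "N > 0" "A_hom N (A_std N n) M f" "l \<in> A_N N {1..n}"
  shows "f l = act M (A_push (\<lambda>i. f (A_unit i)) l)"
proof -
  have "A_push A_unit l \<in> A_N N (A_N N {1..n})"
    using assms by (intro A_push_in_A_N) (auto intro!: A_unit_in_A_N)
  then have "f (A_mult (A_push A_unit l)) = act M (A_push f (A_push A_unit l))"
    using assms(2) by (simp add: A_hom_def A_std_def)
  then show ?thesis
    using A_N_D(1)[OF assms(3)] by (simp add: A_mult_push_unit A_push_comp o_def)
qed

text \<open>Turns evaluation in the free module into the product of the matrix with columns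
  \<open>w k\<close> and the vector \<open>l\<close>.\<close>

lemma A_mult_push_apply:
  fixes l :: "nat \<Rightarrow> rat"
  assumes "l \<in> A_N N {1..n}"
  shows "A_mult (A_push w l) i = (\<Sum>k\<in>{1..n}. l k * w k i)"
  unfolding A_mult_eq_int A_int_push[OF A_N_D(1)[OF assms]]
  by (subst A_int_superset[OF _ A_N_D(2)[OF assms]]) auto

text \<open>Transport of structure along an injection: the action on the copy pulls a combination
  back by the inverse \<open>g\<close>, acts in \<open>M\<close>, and returns by
  \<open>h\<close>.\<close>

lemma A_module_transport:
  fixes M :: "'a alg" and h :: "'a \<Rightarrow> 'b"
  assumes "N > 0" "A_module N M" "inj_on h (carrier M)"
  obtains X :: "'b alg" and g where
    "A_module N X" "A_hom N M X h" "A_hom N X M g" "carrier X = h ` carrier M"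
    "\<And>x. x \<in> carrier M \<Longrightarrow> g (h x) = x"
proof
  define g where "g = inv_into (carrier M) h"
  define X where "X = \<lparr>carrier = h ` carrier M, act = \<lambda>l. h (act M (A_push g l))\<rparr>"
  show gh: "g (h x) = x" if "x \<in> carrier M" for x
    using that assms(3) by (simp add: g_def)
  show cX: "carrier X = h ` carrier M" by (simp add: X_def)
  have actX: "act X l = h (act M (A_push g l))" for l by (simp add: X_def)
  have g: "g ` carrier X \<subseteq> carrier M" using gh by (auto simp: cX)
  have pg: "A_push g l \<in> A_N N (carrier M)" if "l \<in> A_N N (carrier X)" for l
    using A_push_in_A_N[OF assms(1) that g] .
  have actM: "act M l \<in> carrier M" if "l \<in> A_N N (carrier M)" for l
    using that assms(2) by (simp add: A_module_def)
  show "A_hom N M X h"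
    unfolding A_hom_def
  proof (intro conjI ballI)
    fix l assume l: "l \<in> A_N N (carrier M)"
    have "A_push g (A_push h l) = l"
      using A_N_D(1,2)[OF l] gh by (auto simp: A_push_comp intro!: A_push_ident)
    then show "h (act M l) = act X (A_push h l)" by (simp add: actX)
  qed (simp add: cX)
  show "A_hom N X M g"
    unfolding A_hom_def using g pg gh actM by (auto simp: actX)
  show "A_module N X"
    unfolding A_module_def
  proof (intro conjI ballI)
    show "act X l \<in> carrier X" if "l \<in> A_N N (carrier X)" for l
      using pg[OF that] actM by (simp add: actX cX)
  next
    fix L assume L: "L \<in> A_N N (A_N N (carrier X))"
    have ppL: "A_push (A_push g) L \<in> A_N N (A_N N (carrier M))"
      using pg by (intro A_push_in_A_N[OF assms(1) L]) auto
    have "act M (A_push g (A_mult L)) = act M (A_push (act M) (A_push (A_push g) L))"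
      using assms(2) ppL by (simp add: A_push_mult[OF L] A_module_def)
    \<comment> \<open>Both sides are the pushforward of \<open>L\<close> along
      \<open>\<lambda>l. act M (A_push g l)\<close>, because \<open>g\<close> undoes the
      \<open>h\<close> in \<open>act X\<close>.\<close>
    also have "A_push (act M) (A_push (A_push g) L) = A_push g (A_push (act X) L)"
      using A_N_D(1,2)[OF L] pg actM gh
      by (auto simp: A_push_comp actX intro!: A_push_cong)
    finally show "act X (A_mult L) = act X (A_push (act X) L)" by (simp add: actX)
  next
    fix x assume "x \<in> carrier X"
    then show "act X (A_unit x) = x"
      using gh assms(2) by (auto simp: cX actX A_push_unit A_module_def)
  qed
qed

text \<open>A combination over a finite set is determined by its finite list of rational values.
  Countability lets the free module embed into every infinite type.\<close>

lemma countable_A_N: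
  assumes "finite X"
  shows "countable (A_N N X)"
proof -
  obtain xs where xs: "set xs = X" using finite_list[OF assms] by blast
  have "inj_on (\<lambda>l. map l xs) (A_N N X)"
  proof (rule inj_onI)
    fix l l' assume l: "l \<in> A_N N X" "l' \<in> A_N N X" "map l xs = map l' xs"
    then have "l x = l' x" if "x \<in> X" for x using that xs by auto
    moreover have "l x = l' x" if "x \<notin> X" for x
      using that A_N_D(2)[OF l(1)] A_N_D(2)[OF l(2)] unfolding A_supp_def
      by (metis (mono_tags, lifting) mem_Collect_eq subsetD)
    ultimately show "l = l'" by blast
  qed
  then show ?thesis by (rule countable_image_inj_on[rotated]) (rule countableI_type)
qed

text \<open>A section into the copy of the free module, followed by the map \<open>g\<close> back to
  the original, is a section of the given surjection \<open>f\<close>.\<close>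

lemma projective_retract:
  assumes "N > 0" "infinite (UNIV :: 'u set)" "A_projective TYPE('u) N P" "A_fin_gen N P"
  obtains n f s where "A_hom N (A_std N n) P f" "A_hom N P (A_std N n) s"
    "\<And>y. y \<in> carrier P \<Longrightarrow> f (s y) = y"
proof -
  obtain n f where f: "A_hom N (A_std N n) P f" "f ` carrier (A_std N n) = carrier P"
    using assms(4) by (auto simp: A_fin_gen_def)
  obtain e :: "nat \<Rightarrow> 'u" where e: "inj e"
    using assms(2) by (meson infinite_countable_subset)
  define h where "h = e \<circ> to_nat_on (carrier (A_std N n))"
  \<comment> \<open>Projectivity only speaks of sources in \<open>'u\<close>, so the free module is copied there.\<close>
  have "countable (carrier (A_std N n))" by (simp add: A_std_def countable_A_N)
  then have "inj_on h (carrier (A_std N n))"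
    unfolding h_def using e by (intro comp_inj_on inj_on_to_nat_on) (auto intro: inj_on_subset)
  then obtain X :: "'u alg" and g where X: "A_module N X" "A_hom N X (A_std N n) g"
      "carrier X = h ` carrier (A_std N n)" "\<And>x. x \<in> carrier (A_std N n) \<Longrightarrow> g (h x) = x"
    using A_module_transport[OF assms(1) A_std_module[OF assms(1)]] by metis
  have "A_hom N X P (f \<circ> g)" using A_hom_comp[OF assms(1) X(2) f(1)] .
  moreover have "(f \<circ> g) ` carrier X = carrier P"
    using X(3,4) f(2) by (force simp: image_comp)
  ultimately obtain s where "A_hom N P X s" "\<And>y. y \<in> carrier P \<Longrightarrow> (f \<circ> g) (s y) = y"
    using assms(3) X(1) unfolding A_projective_def by blast
  then show ?thesis
    using that[OF f(1) A_hom_comp[OF assms(1) _ X(2)]] by auto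
qed

section \<open>Contractive idempotent matrices\<close>

text \<open>The matrix has the columns \<open>E j\<close>. The set \<open>J\<close> consists of one element of each minimal
  support of a nonzero fixed vector.\<close>

lemma contractive_idempotent:
  fixes E :: "'a \<Rightarrow> 'a \<Rightarrow> 'b :: linordered_field"
  assumes "finite I"
    and contr: "\<And>k. k \<in> I \<Longrightarrow> (\<Sum>i\<in>I. \<bar>E k i\<bar>) \<le> 1"
    and idem: "\<And>j i. j \<in> I \<Longrightarrow> i \<in> I \<Longrightarrow> (\<Sum>k\<in>I. E j k * E k i) = E j i"
  obtains J where "J \<subseteq> I"
    and "\<And>j. j \<in> J \<Longrightarrow> (\<Sum>i\<in>I. \<bar>E j i\<bar>) = 1"
    and "\<And>i j k. i \<in> J \<Longrightarrow> j \<in> J \<Longrightarrow> k \<in> I \<Longrightarrow> E i k \<noteq> 0 \<Longrightarrow> E j k \<noteq> 0 \<Longrightarrow> i = j"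
    and "\<And>x i. (\<And>i. i \<in> I \<Longrightarrow> (\<Sum>k\<in>I. x k * E k i) = x i) \<Longrightarrow> i \<in> I \<Longrightarrow>
           x i = (\<Sum>j\<in>J. x j / E j j * E j i)"
proof -
  define fixd where "fixd x \<longleftrightarrow> (\<forall>i\<in>I. (\<Sum>k\<in>I. x k * E k i) = x i)" for x
  define supp where "supp x = {i \<in> I. x i \<noteq> 0}" for x :: "'a \<Rightarrow> 'b"
  have fixd_E: "fixd (E j)" if "j \<in> I" for j
    using idem that by (auto simp: fixd_def)

  \<comment> \<open>Summing over \<open>i\<close> bounds \<open>\<parallel>x\<parallel>\<close> by itself, so all intermediate estimates are equalities.\<close>
  have no_cancel: "\<bar>x i\<bar> = (\<Sum>k\<in>I. \<bar>x k\<bar> * \<bar>E k i\<bar>)"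
    and no_loss: "x i \<noteq> 0 \<Longrightarrow> (\<Sum>k\<in>I. \<bar>E i k\<bar>) = 1"
    if x: "fixd x" and i: "i \<in> I" for x i
  proof -
    have le: "\<bar>x i\<bar> \<le> (\<Sum>k\<in>I. \<bar>x k\<bar> * \<bar>E k i\<bar>)" if "i \<in> I" for i
      using sum_abs[of "\<lambda>k. x k * E k i" I] x that by (simp add: fixd_def abs_mult)
    have le': "\<bar>x k\<bar> * (\<Sum>i\<in>I. \<bar>E k i\<bar>) \<le> \<bar>x k\<bar>" if "k \<in> I" for k
      using contr[OF that] by (simp add: mult_left_le)
    have sw: "(\<Sum>i\<in>I. \<Sum>k\<in>I. \<bar>x k\<bar> * \<bar>E k i\<bar>) = (\<Sum>k\<in>I. \<bar>x k\<bar> * (\<Sum>i\<in>I. \<bar>E k i\<bar>))"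
      by (subst sum.swap) (simp add: sum_distrib_left)
    have "(\<Sum>i\<in>I. \<bar>x i\<bar>) \<le> (\<Sum>i\<in>I. \<Sum>k\<in>I. \<bar>x k\<bar> * \<bar>E k i\<bar>)"
      using le by (rule sum_mono)
    moreover have "(\<Sum>k\<in>I. \<bar>x k\<bar> * (\<Sum>i\<in>I. \<bar>E k i\<bar>)) \<le> (\<Sum>k\<in>I. \<bar>x k\<bar>)"
      using le' by (rule sum_mono)
    ultimately have eq: "(\<Sum>i\<in>I. \<bar>x i\<bar>) = (\<Sum>i\<in>I. \<Sum>k\<in>I. \<bar>x k\<bar> * \<bar>E k i\<bar>)"
      "(\<Sum>k\<in>I. \<bar>x k\<bar> * (\<Sum>i\<in>I. \<bar>E k i\<bar>)) = (\<Sum>k\<in>I. \<bar>x k\<bar>)"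
      using sw by simp_all
    show "\<bar>x i\<bar> = (\<Sum>k\<in>I. \<bar>x k\<bar> * \<bar>E k i\<bar>)"
      using sum_mono_inv[OF eq(1)] le i \<open>finite I\<close> by blast
    have "\<bar>x i\<bar> * (\<Sum>k\<in>I. \<bar>E i k\<bar>) = \<bar>x i\<bar>"
      using sum_mono_inv[OF eq(2)] le' i \<open>finite I\<close> by blast
    then show "(\<Sum>k\<in>I. \<bar>E i k\<bar>) = 1" if "x i \<noteq> 0" using that by simp
  qed

  \<comment> \<open>By \<open>no_cancel\<close>, \<open>\<bar>x i\<bar>\<close> is a sum of
    nonnegative terms, so a positive term at \<open>k\<close> forces \<open>x i \<noteq> 0\<close>.
    By \<open>no_loss\<close>, column \<open>k\<close> has norm 1 and cannot vanish.\<close>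
  have supp_E: "supp (E k) \<subseteq> supp x" and supp_E_ne: "supp (E k) \<noteq> {}"
    if x: "fixd x" and k: "k \<in> supp x" for x k
  proof -
    have k': "k \<in> I" "x k \<noteq> 0" using k by (auto simp: supp_def)
    show "supp (E k) \<subseteq> supp x"
    proof
      fix i assume "i \<in> supp (E k)"
      then have i: "i \<in> I" "E k i \<noteq> 0" by (auto simp: supp_def)
      have "0 < \<bar>x k\<bar> * \<bar>E k i\<bar>" using k' i by simp
      also have "\<dots> \<le> (\<Sum>k\<in>I. \<bar>x k\<bar> * \<bar>E k i\<bar>)"
        using \<open>finite I\<close> k' by (intro member_le_sum) auto
      also have "\<dots> = \<bar>x i\<bar>" using no_cancel[OF x] i by simp
      finally show "i \<in> supp x" using i by (simp add: supp_def)
    qed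
    show "supp (E k) \<noteq> {}"
    proof
      assume "supp (E k) = {}"
      then have "(\<Sum>i\<in>I. \<bar>E k i\<bar>) = 0" by (intro sum.neutral) (auto simp: supp_def)
      then show False using no_loss[OF x k'] by simp
    qed
  qed

  define minsupp where "minsupp S \<longleftrightarrow> S \<noteq> {} \<and> (\<exists>x. fixd x \<and> supp x = S) \<and>
    (\<forall>y. fixd y \<and> supp y \<noteq> {} \<and> supp y \<subseteq> S \<longrightarrow> supp y = S)" for S
  \<comment> \<open>Column \<open>k\<close> is itself a fixed vector with nonempty support inside
    \<open>S\<close>, so minimality of \<open>S\<close> gives equality. A minimal support is thus
    determined by any one of its points.\<close>
  have min_supp_E: "supp (E k) = S" if S: "minsupp S" "k \<in> S" for k S
  proof -
    obtain x where x: "fixd x" "supp x = S" using S(1) unfolding minsupp_def by blast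
    moreover have "k \<in> I" using x that by (auto simp: supp_def)
    ultimately show ?thesis
      using that supp_E[of x k] supp_E_ne[of x k] fixd_E[of k] by (auto simp: minsupp_def)
  qed
  \<comment> \<open>Descent on the cardinality of the support, which is finite.\<close>
  have ex_min: "\<exists>S. minsupp S \<and> S \<subseteq> supp x" if "fixd x" "supp x \<noteq> {}" for x
    using that
  proof (induction "card (supp x)" arbitrary: x rule: less_induct)
    case less
    show ?case
    proof (cases "minsupp (supp x)")
      case False
      then obtain y where y: "fixd y" "supp y \<noteq> {}" "supp y \<subset> supp x"
        using less.prems by (auto simp: minsupp_def)
      moreover have "finite (supp x)" using \<open>finite I\<close> by (simp add: supp_def)
      ultimately obtain S where "minsupp S" "S \<subseteq> supp y"
        using less.hyps[OF psubset_card_mono] by metis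
      then show ?thesis using y(3) by blast
    qed auto
  qed

  define rep where "rep S = (SOME k. k \<in> S)" for S :: "'a set"
  define J where "J = rep ` {S. minsupp S}"
  have rep: "rep S \<in> S" if "minsupp S" for S
    using that unfolding rep_def minsupp_def by (simp add: some_in_eq)
  have J: "j \<in> I \<and> j = rep (supp (E j)) \<and> minsupp (supp (E j)) \<and> j \<in> supp (E j)" if "j \<in> J" for j
  proof -
    obtain S where S: "minsupp S" "j = rep S" using \<open>j \<in> J\<close> by (auto simp: J_def)
    then have "j \<in> S" using rep by simp
    moreover have "supp (E j) = S" using S(1) \<open>j \<in> S\<close> by (rule min_supp_E)
    moreover have "supp (E j) \<subseteq> I" by (auto simp: supp_def)
    ultimately show ?thesis using S by auto
  qed
  have J_nz: "E j j \<noteq> 0" if "j \<in> J" for j using J[OF that] by (auto simp: supp_def)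
  \<comment> \<open>A common point \<open>k\<close> identifies both supports with that of
    \<open>E k\<close>; equal supports have the same representative.\<close>
  have disj: "i = j" if "i \<in> J" "j \<in> J" "k \<in> I" "E i k \<noteq> 0" "E j k \<noteq> 0" for i j k
  proof -
    have k: "k \<in> supp (E i)" "k \<in> supp (E j)" using that by (simp_all add: supp_def)
    have "supp (E k) = supp (E i)" "supp (E k) = supp (E j)"
      using J that(1,2) k by (metis min_supp_E)+
    then show ?thesis using J that by metis
  qed
  have "J \<subseteq> I" using J by auto
  then have "finite J" using \<open>finite I\<close> finite_subset by blast
  show ?thesis
  proof (rule that[of J])
    show "(\<Sum>i\<in>I. \<bar>E j i\<bar>) = 1" if "j \<in> J" for j
      using no_loss[OF fixd_E] J J_nz that by blast
    fix x i assume x: "\<And>i. i \<in> I \<Longrightarrow> (\<Sum>k\<in>I. x k * E k i) = x i" and i: "i \<in> I"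
    \<comment> \<open>The error of the claimed expansion. It is again fixed and vanishes at every
      representative in \<open>J\<close>; a nonempty support would contain a minimal one, and with
      it a representative.\<close>
    define y where "y i = x i - (\<Sum>j\<in>J. x j / E j j * E j i)" for i
    have "fixd y"
      unfolding fixd_def
    proof
      fix i assume i: "i \<in> I"
      have "(\<Sum>k\<in>I. y k * E k i)
          = x i - (\<Sum>k\<in>I. \<Sum>j\<in>J. x j / E j j * (E j k * E k i))"
        using x[OF i] by (simp add: y_def left_diff_distrib sum_subtractf sum_distrib_right mult.assoc)
      also have "(\<Sum>k\<in>I. \<Sum>j\<in>J. x j / E j j * (E j k * E k i))
          = (\<Sum>j\<in>J. x j / E j j * (\<Sum>k\<in>I. E j k * E k i))"
        by (subst sum.swap) (simp add: sum_distrib_left)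
      also have "\<dots> = (\<Sum>j\<in>J. x j / E j j * E j i)"
        using idem i \<open>J \<subseteq> I\<close> by (intro sum.cong) auto
      finally show "(\<Sum>k\<in>I. y k * E k i) = y i" by (simp add: y_def)
    qed
    \<comment> \<open>By disjointness only column \<open>j\<close> is nonzero at \<open>j\<close>,
      and the coefficient \<open>x j / E j j\<close> is chosen to match \<open>x\<close>
      there.\<close>
    have y_J: "y j = 0" if "j \<in> J" for j
    proof -
      have "(\<Sum>l\<in>J. x l / E l l * E l j) = (\<Sum>l\<in>{j}. x l / E l l * E l j)"
        using \<open>finite J\<close> that disj[OF _ that] J_nz J[OF that]
        by (intro sum.mono_neutral_right) auto
      then show ?thesis using J_nz[OF that] by (simp add: y_def)
    qed
    have "supp y = {}"
    proof (rule ccontr)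
      assume "supp y \<noteq> {}"
      then obtain S where "minsupp S" "S \<subseteq> supp y" using ex_min \<open>fixd y\<close> by blast
      then show False using rep[of S] y_J[of "rep S"] by (auto simp: J_def supp_def)
    qed
    then show "x i = (\<Sum>j\<in>J. x j / E j j * E j i)"
      using i by (auto simp: supp_def y_def)
  qed (use \<open>J \<subseteq> I\<close> disj in auto)
qed

section \<open>Projective modules\<close>

text \<open>The columns selected by \<open>contractive_idempotent\<close> have norm 1 and disjoint
  supports. Hence the map \<open>u\<close> combining them and the map \<open>c\<close> pairing with
  their signs are mutually inverse between \<open>A_N N {1..m}\<close> and the fixed vectors of
  \<open>e\<close>.\<close>

lemma A_std_idempotent_splits:
  assumes "N > 0" and e: "A_hom N (A_std N n) (A_std N n) e"
    and idem: "\<And>x. x \<in> A_N N {1..n} \<Longrightarrow> e (e x) = e x"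
  obtains m u c where "A_hom N (A_std N m) (A_std N n) u" "A_hom N (A_std N n) (A_std N m) c"
    "\<And>y. y \<in> A_N N {1..m} \<Longrightarrow> e (u y) = u y" "\<And>y. y \<in> A_N N {1..m} \<Longrightarrow> c (u y) = y"
    "\<And>x. x \<in> A_N N {1..n} \<Longrightarrow> e x = x \<Longrightarrow> u (c x) = x"
proof -
  define E where "E j = e (A_unit j)" for j
  have E: "E j \<in> A_N N {1..n}" if "j \<in> {1..n}" for j
    using e A_unit_in_A_N[OF that, of N] by (simp add: E_def A_hom_def A_std_def)
  have e_eq: "e x i = (\<Sum>k\<in>{1..n}. x k * E k i)" if "x \<in> A_N N {1..n}" for x i
    using A_hom_std_eq[OF assms(1) e that] A_mult_push_apply[OF that] by (simp add: A_std_def E_def)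
  have idem_E: "(\<Sum>k\<in>{1..n}. E j k * E k i) = E j i" if "j \<in> {1..n}" for j i
    using e_eq[OF E[OF that], of i] idem[OF A_unit_in_A_N[OF that]] by (simp add: E_def)
  obtain J where J: "J \<subseteq> {1..n}" "\<And>j. j \<in> J \<Longrightarrow> (\<Sum>i\<in>{1..n}. \<bar>E j i\<bar>) = 1"
    "\<And>i j k. i \<in> J \<Longrightarrow> j \<in> J \<Longrightarrow> k \<in> {1..n} \<Longrightarrow> E i k \<noteq> 0 \<Longrightarrow> E j k \<noteq> 0 \<Longrightarrow> i = j"
    "\<And>x i. (\<And>i. i \<in> {1..n} \<Longrightarrow> (\<Sum>k\<in>{1..n}. x k * E k i) = x i) \<Longrightarrow> i \<in> {1..n} \<Longrightarrow>
           x i = (\<Sum>j\<in>J. x j / E j j * E j i)"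
  proof (rule contractive_idempotent[of "{1..n}" E])
    show "(\<Sum>i\<in>{1..n}. \<bar>E k i\<bar>) \<le> 1" if "k \<in> {1..n}" for k
      using A_N_norm_le[OF E[OF that]] by simp
  qed (use idem_E in auto)
  obtain h :: "nat \<Rightarrow> nat" and m where h: "bij_betw h {1..m} J"
    using ex_bij_betw_nat_finite_1[OF finite_subset[OF J(1)]] by blast
  have h_inj: "i = j" if "i \<in> {1..m}" "j \<in> {1..m}" "h i = h j" for i j
    using inj_onD[OF bij_betw_imp_inj_on[OF h]] that by metis
  define w where "w i = E (h i)" for i
  have hJ: "h i \<in> J" if "i \<in> {1..m}" for i using bij_betwE[OF h] that by blast
  have w: "w i \<in> A_N N {1..n}" if "i \<in> {1..m}" for i
    using hJ[OF that] J(1) E by (auto simp: w_def)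
  have w_disj: "i = j" if "i \<in> {1..m}" "j \<in> {1..m}" "k \<in> {1..n}" "w i k \<noteq> 0" "w j k \<noteq> 0"
    for i j k
    using h_inj[OF that(1,2)] J(3)[OF hJ[OF that(1)] hJ[OF that(2)] that(3)] that(4,5)
    by (simp add: w_def)
  \<comment> \<open>The sign vectors are dual to the basis: the diagonal pairing is the norm of a
    column, and off the diagonal the supports are disjoint.\<close>
  have w_sgn: "(\<Sum>k\<in>{1..n}. w i k * sgn (w j k)) = of_bool (i = j)"
    if ij: "i \<in> {1..m}" "j \<in> {1..m}" for i j
  proof (cases "i = j")
    case True
    then show ?thesis using J(2)[OF hJ[OF ij(1)]] by (simp add: w_def abs_sgn)
  next
    case False
    then have "w i k * sgn (w j k) = 0" if "k \<in> {1..n}" for k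
      using w_disj[OF ij that] by (cases "w i k = 0") (auto simp: sgn_if)
    then show ?thesis using False by (simp add: sum.neutral)
  qed
  \<comment> \<open>The image of the \<open>k\<close>-th unit under \<open>c\<close>. As the
    supports of the \<open>w i\<close> are disjoint, at most one entry is nonzero, which keeps the
    norm at most 1.\<close>
  define v where "v k = (\<lambda>i. if i \<in> {1..m} then sgn (w i k) else 0)" for k
  have v: "v k \<in> A_N N {1..m}" if k: "k \<in> {1..n}" for k
  proof (rule A_N_I[of "A_supp (v k)"])
    have supp: "A_supp (v k) = {i \<in> {1..m}. w i k \<noteq> 0}"
      by (auto simp: A_supp_def v_def sgn_eq_0_iff)
    then show fin: "finite (A_supp (v k))" and "A_supp (v k) \<subseteq> {1..m}" by auto
    show "A_supp (v k) \<subseteq> A_supp (v k)" ..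
    show "v k i \<in> Z_inv N" for i by (simp add: v_def Z_inv_sgn)
    have "i = j" if "i \<in> A_supp (v k)" "j \<in> A_supp (v k)" for i j
      using w_disj[OF _ _ k, of i j] that unfolding supp by blast
    then have "card (A_supp (v k)) \<le> 1"
      using card_le_Suc0_iff_eq[OF fin] by simp
    moreover have "(\<Sum>i\<in>A_supp (v k). \<bar>v k i\<bar>) \<le> (\<Sum>i\<in>A_supp (v k). 1)"
      by (intro sum_mono) (auto simp: v_def abs_sgn_eq)
    ultimately show "(\<Sum>i\<in>A_supp (v k). \<bar>v k i\<bar>) \<le> 1" by simp
  qed
  define u where "u = (\<lambda>y. A_mult (A_push w y))"
  define c where "c = (\<lambda>x. A_mult (A_push v x))"
  note Nmod = A_std_module[OF assms(1)]
  have carr: "carrier (A_std N p) = A_N N {1..p}" and act: "act (A_std N p) = A_mult" for p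
    by (simp_all add: A_std_def)
  have u_hom: "A_hom N (A_std N m) (A_std N n) u"
    using A_hom_free[OF assms(1) Nmod, of m w n] w unfolding carr act u_def by blast
  have c_hom: "A_hom N (A_std N n) (A_std N m) c"
    using A_hom_free[OF assms(1) Nmod, of n v m] v unfolding carr act c_def by blast
  have u_in: "u y \<in> A_N N {1..n}" if "y \<in> A_N N {1..m}" for y
    using u_hom that by (simp add: A_hom_def A_std_def)
  have c_in: "c x \<in> A_N N {1..m}" if "x \<in> A_N N {1..n}" for x
    using c_hom that by (simp add: A_hom_def A_std_def)
  have u_eq: "u y i = (\<Sum>k\<in>{1..m}. y k * w k i)" if "y \<in> A_N N {1..m}" for y i
    by (simp add: u_def A_mult_push_apply[OF that])
  have c_eq: "c x i = (\<Sum>k\<in>{1..n}. x k * sgn (w i k))" if "x \<in> A_N N {1..n}" "i \<in> {1..m}" for x i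
    using that(2) by (simp add: c_def A_mult_push_apply[OF that(1)] v_def)
  \<comment> \<open>Stated for arbitrary rational coefficients, since it is also applied to
    quotients not yet known to lie in the ring.\<close>
  have coeff: "(\<Sum>k\<in>{1..n}. (\<Sum>l\<in>{1..m}. a l * w l k) * sgn (w i k)) = a i"
    if i: "i \<in> {1..m}" for a :: "nat \<Rightarrow> rat" and i
  proof -
    have "(\<Sum>k\<in>{1..n}. (\<Sum>l\<in>{1..m}. a l * w l k) * sgn (w i k))
        = (\<Sum>l\<in>{1..m}. a l * (\<Sum>k\<in>{1..n}. w l k * sgn (w i k)))"
      unfolding sum_distrib_right by (subst sum.swap) (simp add: sum_distrib_left mult.assoc)
    also have "\<dots> = (\<Sum>l\<in>{1..m}. if l = i then a l else 0)"
      using w_sgn[OF _ i] by (intro sum.cong) auto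
    finally show ?thesis using i by simp
  qed
  \<comment> \<open>Vectors are functions on all of \<open>nat\<close>, so equalities must also be
    checked outside the index range.\<close>
  have out: "x i = 0" if "x \<in> A_N N {1..p}" "i \<notin> {1..p}" for x i p
    using A_N_D(2)[OF that(1)] that(2) by (auto simp: A_supp_def)
  show ?thesis
  proof (rule that[OF u_hom c_hom])
    fix y assume y: "y \<in> A_N N {1..m}"
    \<comment> \<open>Each \<open>w l\<close> is a column of \<open>E\<close> and hence fixed by
      idempotence; linearity extends this to \<open>u y\<close>.\<close>
    show "e (u y) = u y"
    proof
      fix i
      have "e (u y) i = (\<Sum>l\<in>{1..m}. y l * (\<Sum>k\<in>{1..n}. w l k * E k i))"
        unfolding e_eq[OF u_in[OF y]] u_eq[OF y] sum_distrib_right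
        by (subst sum.swap) (simp add: sum_distrib_left mult.assoc)
      also have "\<dots> = u y i"
        unfolding u_eq[OF y] w_def using idem_E[OF subsetD[OF J(1) hJ]] by (intro sum.cong) simp_all
      finally show "e (u y) i = u y i" .
    qed
    show "c (u y) = y"
    proof
      fix i
      show "c (u y) i = y i"
      proof (cases "i \<in> {1..m}")
        case True
        show ?thesis
          unfolding c_eq[OF u_in[OF y] True] u_eq[OF y] by (rule coeff[OF True])
      next
        case False
        then show ?thesis using out[OF y] out[OF c_in[OF u_in[OF y]]] by simp
      qed
    qed
  next
    fix x assume x: "x \<in> A_N N {1..n}" "e x = x"
    \<comment> \<open>These coefficients are a priori only rational. Identifying them with
      \<open>c x\<close> shows that they form an element of \<open>A_N N {1..m}\<close>.\<close>
    define a where "a l = x (h l) / E (h l) (h l)" for l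
    have x_eq: "x i = (\<Sum>l\<in>{1..m}. a l * w l i)" if "i \<in> {1..n}" for i
    proof -
      have "x i = (\<Sum>j\<in>J. x j / E j j * E j i)"
        by (rule J(4)[OF _ that]) (metis e_eq[OF x(1)] x(2))
      also have "\<dots> = (\<Sum>l\<in>{1..m}. a l * w l i)"
        unfolding a_def w_def by (rule sum.reindex_bij_betw[OF h, symmetric])
      finally show ?thesis .
    qed
    have c_x: "c x l = a l" if "l \<in> {1..m}" for l
      unfolding c_eq[OF x(1) that] coeff[OF that, of a, symmetric]
      by (intro sum.cong refl) (simp only: x_eq)
    show "u (c x) = x"
    proof
      fix i
      show "u (c x) i = x i"
      proof (cases "i \<in> {1..n}")
        case True
        show ?thesis
          unfolding u_eq[OF c_in[OF x(1)]] x_eq[OF True] by (intro sum.cong refl) (simp only: c_x)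
      next
        case False
        then show ?thesis using out[OF x(1)] out[OF u_in[OF c_in[OF x(1)]]] by simp
      qed
    qed
  qed
qed

theorem theorem3p4:
  fixes N :: nat and P :: "'a alg"
  assumes "N > 1"
    and "infinite (UNIV :: 'u set)"
    and "A_projective TYPE('u) N P"
    and "A_fin_gen N P"
  shows "A_free N P"
proof -
  have N: "N > 0" using assms(1) by simp
  obtain n f s where f: "A_hom N (A_std N n) P f" and s: "A_hom N P (A_std N n) s"
    and fs: "\<And>y. y \<in> carrier P \<Longrightarrow> f (s y) = y"
    using projective_retract[OF N assms(2-4)] by metis
  have f_in: "f x \<in> carrier P" if "x \<in> A_N N {1..n}" for x
    using f that by (simp add: A_hom_def A_std_def)
  have s_in: "s y \<in> A_N N {1..n}" if "y \<in> carrier P" for y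
    using s that by (simp add: A_hom_def A_std_def)
  \<comment> \<open>The endomorphism \<open>s \<circ> f\<close> is idempotent because
    \<open>f \<circ> s\<close> is the identity on \<open>P\<close>. Its fixed vectors are the image
    of \<open>s\<close>, a copy of \<open>P\<close>, which is then identified with
    \<open>A_N N {1..m}\<close>.\<close>
  obtain m u c where u: "A_hom N (A_std N m) (A_std N n) u"
    and c: "A_hom N (A_std N n) (A_std N m) c"
    and eu: "\<And>y. y \<in> A_N N {1..m} \<Longrightarrow> (s \<circ> f) (u y) = u y"
    and cu: "\<And>y. y \<in> A_N N {1..m} \<Longrightarrow> c (u y) = y"
    and uc: "\<And>x. x \<in> A_N N {1..n} \<Longrightarrow> (s \<circ> f) x = x \<Longrightarrow> u (c x) = x"
    by (rule A_std_idempotent_splits[OF N A_hom_comp[OF N f s]]) (use fs f_in in auto)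
  have "A_iso N P (A_std N m)"
    unfolding A_iso_def
  proof (intro exI conjI ballI)
    show "A_hom N P (A_std N m) (c \<circ> s)" by (rule A_hom_comp[OF N s c])
    show "A_hom N (A_std N m) P (f \<circ> u)" by (rule A_hom_comp[OF N u f])
    show "(f \<circ> u) ((c \<circ> s) y) = y" if "y \<in> carrier P" for y
      using uc[OF s_in] fs that by simp
    show "(c \<circ> s) ((f \<circ> u) y) = y" if "y \<in> carrier (A_std N m)" for y
      using eu cu that by (simp add: A_std_def)
  qed
  then show ?thesis using assms(3) unfolding A_free_def A_projective_def by blast
qed

end
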